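(* Let $\tau$, $\bar\tau$ and, for each $\delta>0$, the initial data $(r_0^\delta,p_0^\delta)$ satisfy the standing assumptions given in the context, and let $u^\delta=(r^\delta,p^\delta)$ be the global classical solution of the viscous system described in the context. Then there is a constant $C>0$, independent of $t$ and $\delta$, such that $$\int_0^1|u^\delta(t,x)|^2\,dx+\delta\int_0^t\int_0^1|u^\delta_x(s,x)|^2\,dx\,ds\le C$$ for all $t\ge0$ and all $\delta>0$.
   Context: Standing assumptions. $\tau\in C^3(\mathbb R)$ satisfies: (i) there are constants $c_1,c_2>0$ with $c_1\le\tau'(r)\le c_2$ for all $r\in\mathbb R$; (ii) $\tau''(r)\ne0$ for all $r\in\mathbb R$; (iii) $\tau'',\tau'''\in L^2(\mathbb R)\cap L^\infty(\mathbb R)$. The function $\bar\tau:\mathbb R_+\to\mathbb R$ is smooth, bounded with bounded derivative, and there is a time $T_\star$ with $\bar\tau'(t)=0$ for all $t\ge T_\star$. Viscous system. For $\delta>0$, $(r^\delta,p^\delta)$ is a global classical solution, with $r^\delta,p^\delta\in C^1(\mathbb R_+;C^0([0,1]))\cap C^0(\mathbb R_+;C^2([0,1]))$, of $$r^\delta_t-p^\delta_x=\delta r^\delta_{xx},\qquad p^\delta_t-\tau(r^\delta)_x=\delta p^\delta_{xx},\qquad (t,x)\in\mathbb R_+\times[0,1],$$ with boundary conditions $p^\delta(t,0)=0$, $r^\delta(t,1)=\tau^{-1}(\bar\tau(t))$, $p^\delta_x(t,1)=0$, $r^\delta_x(t,0)=0$, and initial data $p^\delta(0,x)=p_0^\delta(x)$,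 $r^\delta(0,x)=r_0^\delta(x)$. (Existence of such a solution is known.) Initial data. $r_0,p_0\in L^2(0,1)$ are given, compatible with the boundary conditions $p(t,0)=0$, $r(t,1)=\tau^{-1}(\bar\tau(t))$ of the limiting hyperbolic system $r_t-p_x=0$, $p_t-\tau(r)_x=0$. The functions $r_0^\delta,p_0^\delta\in C^\infty([0,1])$ are mollifications of $r_0$ and $p_0$ satisfying $p_0^\delta(0)=0$, $r_0^\delta(1)=\tau^{-1}(\bar\tau(0))$, $\partial_xp_0^\delta(1)=0$, $\partial_xr_0^\delta(0)=0$; there is a constant $C'$ independent of $\delta$ with $\|r_0^\delta\|_{L^2}+\|p_0^\delta\|_{L^2}+\|\sqrt\delta\,\partial_xr_0^\delta\|_{L^2}+\|\sqrt\delta\,\partial_xp_0^\delta\|_{L^2}\le C'$; and $(r_0^\delta,p_0^\delta)\to(r_0,p_0)$ strongly in $L^2(0,1)$ as $\delta\to0$. Here $|u^\delta|^2=(r^\delta)^2+(p^\delta)^2$ and $|u^\delta_x|^2=(r^\delta_x)^2+(p^\delta_x)^2$. *)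

theory Defs
  imports "HOL-Analysis.Analysis"
begin

section \<open>Derivatives relative to a set\<close>

text \<open>One-sided at the end points of an interval.  Only meaningful at points of differentiability
  that are limit points of \<open>S\<close>; this is the case wherever it is used below.\<close>

definition deriv_on :: "real set \<Rightarrow> (real \<Rightarrow> real) \<Rightarrow> real \<Rightarrow> real" where
  "deriv_on S f x = vector_derivative f (at x within S)"

lemma deriv_on_eqI:
  assumes "(f has_real_derivative D) (at x within S)" and "at x within S \<noteq> bot"
  shows "deriv_on S f x = D"
  using assms
  by (simp add: deriv_on_def has_real_derivative_iff_has_vector_derivative vector_derivative_within)

lemma deriv_on_UNIV: "deriv_on UNIV f = deriv f"
  by (simp add: fun_eq_iff deriv_on_def deriv_def vector_derivative_def
      has_real_derivative_iff_has_vector_derivative)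

definition Ck_on :: "nat \<Rightarrow> real set \<Rightarrow> (real \<Rightarrow> real) \<Rightarrow> bool" where
  "Ck_on k S f \<longleftrightarrow>
     (\<forall>i<k. (deriv_on S ^^ i) f differentiable_on S) \<and>
     (\<forall>i\<le>k. continuous_on S ((deriv_on S ^^ i) f))"

definition smooth_fun_on :: "real set \<Rightarrow> (real \<Rightarrow> real) \<Rightarrow> bool" where
  "smooth_fun_on S f \<longleftrightarrow> (\<forall>k. Ck_on k S f)"

section \<open>Lebesgue spaces\<close>

definition L2_on :: "real set \<Rightarrow> (real \<Rightarrow> real) \<Rightarrow> bool" where
  "L2_on S f \<longleftrightarrow>
     f \<in> borel_measurable (lebesgue_on S) \<and> integrable (lebesgue_on S) (\<lambda>x. (f x)\<^sup>2)"

definition L2norm_on :: "real set \<Rightarrow> (real \<Rightarrow> real) \<Rightarrow> real" where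
  "L2norm_on S f = sqrt (LINT x|lebesgue_on S. (f x)\<^sup>2)"

definition Linf_on :: "real set \<Rightarrow> (real \<Rightarrow> real) \<Rightarrow> bool" where
  "Linf_on S f \<longleftrightarrow>
     f \<in> borel_measurable (lebesgue_on S) \<and> (\<exists>M. AE x in lebesgue_on S. \<bar>f x\<bar> \<le> M)"

section \<open>Functions of time and space\<close>

text \<open>Functions \<open>u\<close> on \<open>[0,\<infinity>) \<times> [0,1]\<close> are written \<open>u t x\<close>.\<close>

abbreviation dx :: "(real \<Rightarrow> real) \<Rightarrow> real \<Rightarrow> real" where
  "dx \<equiv> deriv_on {0..1}"

definition dt :: "(real \<Rightarrow> real \<Rightarrow> real) \<Rightarrow> real \<Rightarrow> real \<Rightarrow> real" where
  "dt u t x = deriv_on {0..} (\<lambda>s. u s x) t"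

text \<open>In both spaces below, continuity and differentiability in time are those of maps into the
  Banach space \<open>C\<^sup>0([0,1])\<close> resp. \<open>C\<^sup>2([0,1])\<close>; convergence in the sup norm over \<open>[0,1]\<close> is uniform
  convergence there.  Continuity of \<open>u\<close> itself in time follows from differentiability.\<close>

definition C1_time_C0_space :: "(real \<Rightarrow> real \<Rightarrow> real) \<Rightarrow> bool" where
  "C1_time_C0_space u \<longleftrightarrow>
     (\<forall>t\<ge>0. continuous_on {0..1} (u t) \<and> continuous_on {0..1} (dt u t)) \<and>
     (\<forall>t\<ge>0. uniform_limit {0..1} (\<lambda>s x. (u s x - u t x) / (s - t)) (dt u t) (at t within {0..})) \<and>
     (\<forall>t\<ge>0. uniform_limit {0..1} (dt u) (dt u t) (at t within {0..}))"

definition C0_time_C2_space :: "(real \<Rightarrow> real \<Rightarrow> real) \<Rightarrow> bool" where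
  "C0_time_C2_space u \<longleftrightarrow>
     (\<forall>t\<ge>0. Ck_on 2 {0..1} (u t)) \<and>
     (\<forall>t\<ge>0. \<forall>i\<le>2. uniform_limit {0..1} (\<lambda>s. (dx ^^ i) (u s)) ((dx ^^ i) (u t)) (at t within {0..}))"

section \<open>The viscous system and its data\<close>

definition tension :: "(real \<Rightarrow> real) \<Rightarrow> bool" where
  "tension \<tau> \<longleftrightarrow>
     Ck_on 3 UNIV \<tau> \<and>
     (\<exists>c1>0. \<exists>c2>0. \<forall>r. c1 \<le> deriv \<tau> r \<and> deriv \<tau> r \<le> c2) \<and>
     (\<forall>r. (deriv ^^ 2) \<tau> r \<noteq> 0) \<and>
     L2_on UNIV ((deriv ^^ 2) \<tau>) \<and> Linf_on UNIV ((deriv ^^ 2) \<tau>) \<and>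
     L2_on UNIV ((deriv ^^ 3) \<tau>) \<and> Linf_on UNIV ((deriv ^^ 3) \<tau>)"

definition boundary_tension :: "(real \<Rightarrow> real) \<Rightarrow> bool" where
  "boundary_tension \<tau>b \<longleftrightarrow>
     smooth_fun_on {0..} \<tau>b \<and>
     bounded (\<tau>b ` {0..}) \<and> bounded (deriv_on {0..} \<tau>b ` {0..}) \<and>
     (\<exists>T\<ge>0. \<forall>t\<ge>T. deriv_on {0..} \<tau>b t = 0)"

text \<open>\<open>r0\<close> and \<open>p0\<close> represent elements of \<open>L\<^sup>2(0,1)\<close>.  These have no traces, so their compatibility
  with the boundary conditions is a condition on the chosen representatives: every class has
  representatives taking the prescribed values at the end points.\<close>

definition limit_initial_data ::
  "(real \<Rightarrow> real) \<Rightarrow> (real \<Rightarrow> real) \<Rightarrow> (real \<Rightarrow> real) \<Rightarrow> (real \<Rightarrow> real) \<Rightarrow> bool" where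
  "limit_initial_data \<tau> \<tau>b r0 p0 \<longleftrightarrow>
     L2_on {0<..<1} r0 \<and> L2_on {0<..<1} p0 \<and>
     p0 0 = 0 \<and> r0 1 = inv \<tau> (\<tau>b 0)"

text \<open>A family of mollified data, indexed by the viscosity \<open>\<delta>\<close>.  No particular mollifying kernel is
  prescribed (plain convolution would not respect the boundary conditions): a mollification is
  a smooth approximation with the listed properties.\<close>

definition mollified_initial_data ::
  "(real \<Rightarrow> real) \<Rightarrow> (real \<Rightarrow> real) \<Rightarrow> (real \<Rightarrow> real) \<Rightarrow> (real \<Rightarrow> real) \<Rightarrow>
   (real \<Rightarrow> real \<Rightarrow> real) \<Rightarrow> (real \<Rightarrow> real \<Rightarrow> real) \<Rightarrow> bool" where
  "mollified_initial_data \<tau> \<tau>b r0 p0 r0\<delta> p0\<delta> \<longleftrightarrow>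
     (\<forall>\<delta>>0. smooth_fun_on {0..1} (r0\<delta> \<delta>) \<and> smooth_fun_on {0..1} (p0\<delta> \<delta>) \<and>
        p0\<delta> \<delta> 0 = 0 \<and> r0\<delta> \<delta> 1 = inv \<tau> (\<tau>b 0) \<and>
        dx (p0\<delta> \<delta>) 1 = 0 \<and> dx (r0\<delta> \<delta>) 0 = 0) \<and>
     (\<exists>C'. \<forall>\<delta>>0. L2norm_on {0<..<1} (r0\<delta> \<delta>) + L2norm_on {0<..<1} (p0\<delta> \<delta>)
        + L2norm_on {0<..<1} (\<lambda>x. sqrt \<delta> * dx (r0\<delta> \<delta>) x)
        + L2norm_on {0<..<1} (\<lambda>x. sqrt \<delta> * dx (p0\<delta> \<delta>) x) \<le> C') \<and>
     ((\<lambda>\<delta>. L2norm_on {0<..<1} (\<lambda>x. r0\<delta> \<delta> x - r0 x)) \<longlongrightarrow> 0) (at_right 0) \<and>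
     ((\<lambda>\<delta>. L2norm_on {0<..<1} (\<lambda>x. p0\<delta> \<delta> x - p0 x)) \<longlongrightarrow> 0) (at_right 0)"

definition viscous_solution ::
  "real \<Rightarrow> (real \<Rightarrow> real) \<Rightarrow> (real \<Rightarrow> real) \<Rightarrow> (real \<Rightarrow> real) \<Rightarrow> (real \<Rightarrow> real) \<Rightarrow>
   (real \<Rightarrow> real \<Rightarrow> real) \<Rightarrow> (real \<Rightarrow> real \<Rightarrow> real) \<Rightarrow> bool" where
  "viscous_solution \<delta> \<tau> \<tau>b rin pin r p \<longleftrightarrow>
     C1_time_C0_space r \<and> C0_time_C2_space r \<and>
     C1_time_C0_space p \<and> C0_time_C2_space p \<and>
     (\<forall>t\<ge>0. \<forall>x\<in>{0..1}.
        dt r t x - dx (p t) x = \<delta> * (dx ^^ 2) (r t) x \<and>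
        dt p t x - dx (\<lambda>y. \<tau> (r t y)) x = \<delta> * (dx ^^ 2) (p t) x) \<and>
     (\<forall>t\<ge>0. p t 0 = 0 \<and> r t 1 = inv \<tau> (\<tau>b t) \<and> dx (p t) 1 = 0 \<and> dx (r t) 0 = 0) \<and>
     (\<forall>x\<in>{0..1}. p 0 x = pin x \<and> r 0 x = rin x)"

end

theory Submission
  imports Defs
begin

text \<open>The bound is an energy estimate. Let \<open>F\<close> be the antiderivative of \<open>\<tau>\<close> with \<open>F 0 = 0\<close>, the elastic
  potential; the bounds \<open>c\<^sub>1 \<le> \<tau>' \<le> c\<^sub>2\<close> place it between two parabolas. Subtracting from the
  mechanical energy the work of the boundary force gives
  \<open>H(t) = \<integral> (p\<^sup>2/2 + F(r) - \<tau>b(t) r + K) dx\<close>, where the constant \<open>K\<close> only serves to make \<open>H\<close> positive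
  and is chosen from a bound on \<open>\<tau>b\<close>. For a solution of the viscous system
  \<open>p p\<^sub>t + (\<tau>(r) - \<tau>b) r\<^sub>t + \<delta> (p\<^sub>x\<^sup>2 + \<tau>'(r) r\<^sub>x\<^sup>2)\<close> is the \<open>x\<close>-derivative of
  \<open>p (\<tau>(r) - \<tau>b) + \<delta> p p\<^sub>x + \<delta> (\<tau>(r) - \<tau>b) r\<^sub>x\<close>, and the boundary conditions
  make every term of this flux vanish at both ends: \<open>p = r\<^sub>x = 0\<close> on the left, \<open>\<tau>(r) = \<tau>b\<close> and
  \<open>p\<^sub>x = 0\<close> on the right (lemma \<open>flux_identity\<close>). Hence (lemma \<open>energy_identity\<close>)
  \<open>H' = - \<tau>b' \<integral> r dx - \<delta> \<integral> (p\<^sub>x\<^sup>2 + \<tau>'(r) r\<^sub>x\<^sup>2) dx\<close>.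

  The last term is the dissipation to be controlled. The first one is at most a multiple of \<open>H\<close>,
  because \<open>H\<close> dominates \<open>\<integral> (r\<^sup>2 + p\<^sup>2 + 1) dx\<close> (lemma \<open>energy_density_bounds\<close>), and it disappears
  when \<open>\<tau>b\<close> becomes constant. So \<open>H\<close> can grow exponentially, but only during a fixed finite time
  (lemma \<open>dissipative_gronwall\<close>); this is why the resulting bound does not depend on \<open>t\<close>. None of the
  constants involves \<open>\<delta>\<close>, and \<open>H(0)\<close> is controlled by the \<open>L\<^sup>2\<close> norms of the initial data, which are
  bounded uniformly in \<open>\<delta>\<close>.\<close>

section \<open>Regularity of functions of time and space\<close>

lemma Ck_on_has_derivative:
  assumes "Ck_on k S f" and "i < k" and "x \<in> S" and "at x within S \<noteq> bot"
  shows "((deriv_on S ^^ i) f has_real_derivative (deriv_on S ^^ Suc i) f x) (at x within S)"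
proof -
  have "(deriv_on S ^^ i) f differentiable at x within S"
    using assms unfolding Ck_on_def differentiable_on_def by blast
  then obtain D where D: "((deriv_on S ^^ i) f has_real_derivative D) (at x within S)"
    using real_differentiableE by blast
  with deriv_on_eqI[OF D assms(4)] show ?thesis by simp
qed

lemma Ck_on_continuous:
  assumes "Ck_on k S f" and "i \<le> k"
  shows "continuous_on S ((deriv_on S ^^ i) f)"
  using assms unfolding Ck_on_def by blast

lemma at_within_unit_interval: "x \<in> {0..1} \<Longrightarrow> at x within {0..1::real} \<noteq> bot"
  by (simp add: trivial_limit_within islimpt_Icc)

lemma at_within_half_line: "0 \<le> t \<Longrightarrow> at t within {0::real..} \<noteq> bot"
proof -
  assume "0 \<le> t"
  then have "t islimpt {0..t+1}" by (simp add: islimpt_Icc)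
  then have "t islimpt {0..}" by (rule islimpt_subset) auto
  then show ?thesis by (simp add: trivial_limit_within)
qed

text \<open>A map into \<open>C\<^sup>0([0,1])\<close> that is continuous in time is jointly continuous. This is what turns the
  Banach space valued regularity of the solution into the hypotheses needed for
  differentiation under the integral.\<close>

lemma continuous_on_time_space:
  fixes g :: "real \<Rightarrow> real \<Rightarrow> real"
  assumes cont: "\<And>t. 0 \<le> t \<Longrightarrow> continuous_on {0..1} (g t)"
    and lim: "\<And>t. 0 \<le> t \<Longrightarrow> uniform_limit {0..1} g (g t) (at t within {0..})"
  shows "continuous_on ({0..} \<times> {0..1}) (\<lambda>(t, x). g t x)"
  unfolding continuous_on_iff
proof (intro ballI allI impI)
  fix z :: "real \<times> real" and e :: real
  assume z: "z \<in> {0..} \<times> {0..1}" and e: "e > 0"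
  obtain t x where tx: "z = (t, x)" "0 \<le> t" "x \<in> {0..1}" using z by auto
  obtain d1 where d1: "d1 > 0"
    "\<And>s y. s \<ge> 0 \<Longrightarrow> s \<noteq> t \<Longrightarrow> dist s t < d1 \<Longrightarrow> y \<in> {0..1} \<Longrightarrow> dist (g s y) (g t y) < e/2"
    using uniform_limitD[OF lim[OF tx(2)], of "e/2"] e unfolding eventually_at by fastforce
  obtain d2 where d2: "d2 > 0"
    "\<And>y. y \<in> {0..1} \<Longrightarrow> dist y x < d2 \<Longrightarrow> dist (g t y) (g t x) < e/2"
    using cont[OF tx(2)] tx(3) e unfolding continuous_on_iff by (meson half_gt_zero)
  show "\<exists>d>0. \<forall>w\<in>{0..} \<times> {0..1}. dist w z < d \<longrightarrow>
          dist (case w of (s, y) \<Rightarrow> g s y) (case z of (s, y) \<Rightarrow> g s y) < e"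
  proof (intro exI[of _ "min d1 d2"] conjI ballI impI)
    show "min d1 d2 > 0" using d1 d2 by simp
    fix w :: "real \<times> real" assume w: "w \<in> {0..} \<times> {0..1}" "dist w z < min d1 d2"
    obtain s y where sy: "w = (s, y)" "0 \<le> s" "y \<in> {0..1}" using w by auto
    have "dist s t \<le> dist w z" "dist y x \<le> dist w z"
      using dist_fst_le[of w z] dist_snd_le[of w z] by (simp_all add: sy tx)
    with w(2) have st: "dist s t < d1" "dist y x < d2" by simp_all
    have "dist (g s y) (g t y) < e/2"
      using d1(2)[OF sy(2) _ st(1) sy(3)] e by (cases "s = t") auto
    moreover have "dist (g t y) (g t x) < e/2" using d2(2) sy st by blast
    ultimately show "dist (case w of (s, y) \<Rightarrow> g s y) (case z of (s, y) \<Rightarrow> g s y) < e"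
      using dist_triangle_half_r[of "g t y" "g s y" e "g t x"] by (simp add: sy tx dist_commute)
  qed
qed

lemma C1_time_has_derivative:
  assumes "C1_time_C0_space u" and "0 \<le> t" and "x \<in> {0..1}"
  shows "((\<lambda>s. u s x) has_real_derivative dt u t x) (at t within {0..})"
proof -
  have "uniform_limit {0..1} (\<lambda>s x. (u s x - u t x) / (s - t)) (dt u t) (at t within {0..})"
    using assms unfolding C1_time_C0_space_def by blast
  from tendsto_uniform_limitI[OF this assms(3)] show ?thesis
    unfolding has_field_derivative_iff .
qed

lemma C1_time_continuous_dt:
  assumes "C1_time_C0_space u"
  shows "continuous_on ({0..} \<times> {0..1}) (\<lambda>(t, x). dt u t x)"
  using assms unfolding C1_time_C0_space_def by (intro continuous_on_time_space) auto

lemma C2_space_continuous: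
  assumes "C0_time_C2_space u" and "i \<le> 2"
  shows "continuous_on ({0..} \<times> {0..1}) (\<lambda>(t, x). (dx ^^ i) (u t) x)"
  using assms unfolding C0_time_C2_space_def
  by (intro continuous_on_time_space) (auto simp: Ck_on_def)

lemma C2_space_has_derivative:
  assumes "C0_time_C2_space u" and "0 \<le> t" and "i < 2" and "x \<in> {0..1}"
  shows "((dx ^^ i) (u t) has_real_derivative (dx ^^ Suc i) (u t) x) (at x within {0..1})"
  using assms unfolding C0_time_C2_space_def
  by (intro Ck_on_has_derivative[of 2] at_within_unit_interval) auto

lemma slice_has_derivative:
  assumes "C0_time_C2_space u" and "0 \<le> t" and "x \<in> {0..1}"
  shows "(u t has_real_derivative dx (u t) x) (at x within {0..1})"
    and "(dx (u t) has_real_derivative (dx ^^ 2) (u t) x) (at x within {0..1})"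
  using C2_space_has_derivative[OF assms(1,2) _ assms(3), of 0]
    C2_space_has_derivative[OF assms(1,2) _ assms(3), of 1]
  by (simp_all add: numeral_2_eq_2)

lemma continuous_on_sections:
  assumes "C0_time_C2_space u"
  shows "continuous_on ({0..} \<times> {0..1}) (\<lambda>z. u (fst z) (snd z))"
    and "continuous_on ({0..} \<times> {0..1}) (\<lambda>z. dx (u (fst z)) (snd z))"
    and "0 \<le> t \<Longrightarrow> continuous_on {0..1} (u t)"
    and "0 \<le> t \<Longrightarrow> continuous_on {0..1} (dx (u t))"
  using C2_space_continuous[OF assms, of 0] C2_space_continuous[OF assms, of 1]
    DERIV_continuous_on[OF slice_has_derivative(1)[OF assms]]
    DERIV_continuous_on[OF slice_has_derivative(2)[OF assms]]
  by (simp_all add: split_beta)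

section \<open>Tension and elastic potential\<close>

lemma tension_derivatives:
  assumes "Ck_on 3 UNIV \<tau>"
  shows "(\<tau> has_real_derivative deriv \<tau> x) (at x)" and "continuous_on UNIV (deriv \<tau>)"
  using Ck_on_has_derivative[OF assms, of 0 x] Ck_on_continuous[OF assms, of 1]
  by (simp_all add: deriv_on_UNIV)

text \<open>Needed because the boundary value \<open>inv \<tau> (\<tau>b t)\<close> of \<open>r\<close> is only a solution of \<open>\<tau> r = \<tau>b t\<close> if
  \<open>\<tau>b t\<close> lies in the range of \<open>\<tau>\<close>.\<close>

lemma surj_of_deriv_bounded_below:
  fixes f f' :: "real \<Rightarrow> real"
  assumes d: "\<And>x. (f has_real_derivative f' x) (at x)" and c: "c > 0" "\<And>x. c \<le> f' x"
  shows "surj f"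
proof -
  have lin: "f x + c * (y - x) \<le> f y" if "x \<le> y" for x y
  proof -
    have "f x - c * x \<le> f y - c * y"
    proof (rule DERIV_nonneg_imp_nondecreasing[OF that])
      fix z
      have "((\<lambda>x. f x - c * x) has_real_derivative f' z - c) (at z)"
        by (auto intro!: derivative_eq_intros d)
      with c(2) show "\<exists>D. ((\<lambda>x. f x - c * x) has_real_derivative D) (at z) \<and> 0 \<le> D" by force
    qed
    then show ?thesis by (simp add: algebra_simps)
  qed
  have "\<exists>x. f x = y" for y
  proof -
    define h where "h = \<bar>y - f 0\<bar> / c"
    have h: "0 \<le> h" "c * h = \<bar>y - f 0\<bar>" using c by (simp_all add: h_def)
    have "f (-h) \<le> y" "y \<le> f h" using lin[of "-h" 0] lin[of 0 h] h by auto
    moreover have "continuous_on {-h..h} f"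
      using d by (meson DERIV_continuous continuous_at_imp_continuous_on)
    ultimately show ?thesis using IVT'[of f "-h" y h] h(1) by auto
  qed
  then show ?thesis by (metis surjI)
qed

text \<open>The two parabolas come from the Taylor expansion \<open>F x = \<tau> 0 * x + \<tau>' z / 2 * x\<^sup>2\<close> at \<open>0\<close>.\<close>

lemma potential_exists:
  assumes C: "Ck_on 3 UNIV \<tau>"
    and b: "\<And>x. c1 \<le> deriv \<tau> x" "\<And>x. deriv \<tau> x \<le> c2"
  obtains F where "\<And>x. (F has_real_derivative \<tau> x) (at x)"
    and "\<And>x. \<tau> 0 * x + c1 / 2 * x\<^sup>2 \<le> F x" and "\<And>x. F x \<le> \<tau> 0 * x + c2 / 2 * x\<^sup>2"
proof -
  note d = tension_derivatives(1)[OF C]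
  have "isCont \<tau> x" for x using DERIV_isCont[OF d] .
  then obtain F0 where F0: "\<And>x. (F0 has_real_derivative \<tau> x) (at x)"
    using einterval_antiderivative[of "-\<infinity>" \<infinity> \<tau>]
    by (auto simp: has_real_derivative_iff_has_vector_derivative)
  define F where "F = (\<lambda>x. F0 x - F0 0)"
  have F: "(F has_real_derivative \<tau> x) (at x)" for x
    unfolding F_def by (auto intro!: derivative_eq_intros F0)
  have taylor: "\<exists>z. F x = \<tau> 0 * x + deriv \<tau> z / 2 * x\<^sup>2" for x
  proof -
    have D: "(([F, \<tau>, deriv \<tau>] ! m) has_real_derivative ([F, \<tau>, deriv \<tau>] ! Suc m) t) (at t)"
      if "m < 2" for m t
      using that F d by (auto simp: less_2_cases_iff)
    from Maclaurin_bi_le[of "\<lambda>m. [F, \<tau>, deriv \<tau>] ! m" F 2 x] D obtain z where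
      "F x = (\<Sum>m<2. ([F, \<tau>, deriv \<tau>] ! m) 0 / fact m * x ^ m) + ([F, \<tau>, deriv \<tau>] ! 2) z / fact 2 * x\<^sup>2"
      by auto
    then show ?thesis by (auto simp: eval_nat_numeral F_def)
  qed
  show ?thesis
  proof (rule that[OF F])
    fix x
    obtain z where z: "F x = \<tau> 0 * x + deriv \<tau> z / 2 * x\<^sup>2" using taylor by blast
    show "\<tau> 0 * x + c1 / 2 * x\<^sup>2 \<le> F x" "F x \<le> \<tau> 0 * x + c2 / 2 * x\<^sup>2"
      unfolding z using b by (auto intro!: mult_right_mono divide_right_mono)
  qed
qed

text \<open>The density \<open>p\<^sup>2/2 + F(r) - b r\<close> of the energy is comparable to \<open>r\<^sup>2 + p\<^sup>2\<close> up to constants: the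
  quadratic lower bound on the potential absorbs the linear terms by Young's inequality, at the
  price of the constant \<open>A\<^sup>2 / c1\<close>. The further constant \<open>a\<close> gives room for the \<open>1\<close> on the left,
  so that the density also dominates \<open>\<bar>r\<bar> \<le> r\<^sup>2 + 1\<close>.\<close>

lemma energy_density_bounds:
  fixes A b c1 c2 t0 r p Fr :: real
  assumes c: "0 < c1" and A: "\<bar>t0\<bar> + \<bar>b\<bar> \<le> A"
    and lower: "t0 * r + c1 / 2 * r\<^sup>2 \<le> Fr" and upper: "Fr \<le> t0 * r + c2 / 2 * r\<^sup>2"
    and c12: "c1 \<le> c2"
  defines "a \<equiv> min (1/2) (c1/4)"
  shows "a * (r\<^sup>2 + p\<^sup>2 + 1) \<le> p\<^sup>2 / 2 + Fr - b * r + (A\<^sup>2 / c1 + a)"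
    and "p\<^sup>2 / 2 + Fr - b * r + (A\<^sup>2 / c1 + a) \<le> (1/2 + A + c2/2) * (r\<^sup>2 + p\<^sup>2) + (A + A\<^sup>2 / c1 + a)"
proof -
  have lin: "\<bar>(t0 - b) * r\<bar> \<le> A * \<bar>r\<bar>"
    unfolding abs_mult using A by (intro mult_right_mono) auto
  have "0 \<le> (c1 * \<bar>r\<bar> / 2 - A)\<^sup>2 / c1" using c by simp
  then have young: "A * \<bar>r\<bar> \<le> c1 / 4 * r\<^sup>2 + A\<^sup>2 / c1"
    using c by (simp add: power2_diff power_mult_distrib field_simps power2_eq_square abs_mult_self_eq)
  have "a * r\<^sup>2 \<le> c1 / 4 * r\<^sup>2" "a * p\<^sup>2 \<le> 1 / 2 * p\<^sup>2"
    by (intro mult_right_mono; simp add: a_def)+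
  then show "a * (r\<^sup>2 + p\<^sup>2 + 1) \<le> p\<^sup>2 / 2 + Fr - b * r + (A\<^sup>2 / c1 + a)"
    using lower lin young by (simp add: algebra_simps)
  have A0: "0 \<le> A" using A by linarith
  have "0 \<le> (\<bar>r\<bar> - 1)\<^sup>2" by simp
  then have "2 * \<bar>r\<bar> \<le> r\<^sup>2 + 1" by (simp add: power2_diff)
  moreover have "0 \<le> r\<^sup>2" by simp
  ultimately have "\<bar>r\<bar> \<le> r\<^sup>2 + 1" by linarith
  then have r_lin: "A * \<bar>r\<bar> \<le> A * (r\<^sup>2 + 1)" using A0 by (rule mult_left_mono)
  have nonneg: "0 \<le> A * p\<^sup>2" "0 \<le> c2 / 2 * p\<^sup>2" "0 \<le> r\<^sup>2" using A0 c c12 by simp_all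
  have expand: "(1/2 + A + c2/2) * (r\<^sup>2 + p\<^sup>2)
      = r\<^sup>2 / 2 + p\<^sup>2 / 2 + (A * (r\<^sup>2 + 1) - A) + A * p\<^sup>2 + c2 / 2 * r\<^sup>2 + c2 / 2 * p\<^sup>2"
    by (simp add: field_simps)
  have "t0 * r - b * r \<le> A * \<bar>r\<bar>" using lin by (simp add: left_diff_distrib)
  then show "p\<^sup>2 / 2 + Fr - b * r + (A\<^sup>2 / c1 + a) \<le> (1/2 + A + c2/2) * (r\<^sup>2 + p\<^sup>2) + (A + A\<^sup>2 / c1 + a)"
    using upper r_lin nonneg expand by linarith
qed

section \<open>Growth during a finite time\<close>

text \<open>Until time \<open>T\<close> the dissipation \<open>D\<close> is kept alongside \<open>H\<close> by an integrating factor; afterwards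
  \<open>H + \<integral> D\<close> does not increase, so the bound reached at \<open>T\<close> persists.\<close>

lemma dissipative_gronwall:
  fixes H H' D :: "real \<Rightarrow> real"
  assumes H: "\<And>t. 0 \<le> t \<Longrightarrow> (H has_real_derivative H' t) (at t within {0..})"
    and D: "continuous_on {0..} D" and pos: "\<And>t. 0 \<le> t \<Longrightarrow> 0 \<le> D t" and T: "0 \<le> T" and M: "0 \<le> M"
    and early: "\<And>t. 0 \<le> t \<Longrightarrow> H' t \<le> M * H t - D t"
    and late: "\<And>t. T \<le> t \<Longrightarrow> H' t \<le> - D t"
    and Hpos: "\<And>t. 0 \<le> t \<Longrightarrow> 0 \<le> H t"
    and t: "0 \<le> t"
  shows "H t + integral {0..t} D \<le> exp (M * T) * H 0"
proof -
  define I where "I = (\<lambda>t. integral {0..t} D)"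
  have Hat: "(H has_real_derivative H' t) (at t)" if "0 < t" for t
    using H[of t] that at_within_interior[of t "{0..}"] by simp
  have Iw: "(I has_real_derivative D t) (at t within {0..s})" if "0 \<le> t" "t \<le> s" for t s
    unfolding I_def using that
    by (intro integral_has_real_derivative continuous_on_subset[OF D]) auto
  have Iat: "(I has_real_derivative D t) (at t)" if "0 < t" for t
    using Iw[of t "t+1"] that at_within_interior[of t "{0..t+1}"] by simp
  have contH: "continuous_on {a..b} H" if "0 \<le> a" for a b
  proof (rule continuous_on_subset)
    show "continuous_on {0..} H" by (rule DERIV_continuous_on) (use H in auto)
  qed (use that in auto)
  have contI: "continuous_on {a..b} I" if "0 \<le> a" for a b
  proof (rule continuous_on_subset)
    show "continuous_on {0..b} I" by (rule DERIV_continuous_on) (use Iw in auto)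
  qed (use that in auto)
  have I0: "I 0 = 0" by (simp add: I_def)
  have Ipos: "0 \<le> I t" if "0 \<le> t" for t
    unfolding I_def using pos
    by (intro integral_nonneg integrable_continuous_interval continuous_on_subset[OF D]) auto
  have up_to_T: "H s + I s \<le> exp (M * T) * H 0" if s: "0 \<le> s" "s \<le> T" for s
  proof -
    \<comment> \<open>Freezing the weight of the accumulated dissipation at the final time \<open>s\<close> gives it the least
      value of \<open>exp (- M * z)\<close> on \<open>[0, s]\<close>, so the dissipation in \<open>H'\<close> still outweighs it.\<close>
    define W where "W = (\<lambda>t. exp (- M * t) * H t + exp (- M * s) * I t)"
    have "W s \<le> W 0"
    proof (rule DERIV_nonpos_imp_decreasing_open[OF s(1)])
      fix z assume z: "0 < z" "z < s"
      have dW: "(W has_real_derivative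
          exp (- M * z) * (H' z - M * H z) + exp (- M * s) * D z) (at z)"
        unfolding W_def using z
        by (auto intro!: derivative_eq_intros Hat Iat simp: algebra_simps)
      have "exp (- M * z) * (H' z - M * H z) \<le> exp (- M * z) * (- D z)"
        using early[of z] z by (intro mult_left_mono) auto
      moreover have "exp (- M * s) * D z \<le> exp (- M * z) * D z"
        using mult_left_mono[of z s M] z M pos[of z] by (intro mult_right_mono) simp_all
      ultimately have "exp (- M * z) * (H' z - M * H z) + exp (- M * s) * D z \<le> 0" by simp
      with dW show "\<exists>y. (W has_real_derivative y) (at z) \<and> y \<le> 0" by blast
    next
      show "continuous_on {0..s} W"
        unfolding W_def by (intro continuous_intros contH contI) auto
    qed
    then have "exp (- M * s) * (H s + I s) \<le> H 0" by (simp add: W_def I0 algebra_simps)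
    then have "H s + I s \<le> exp (M * s) * H 0"
      by (simp add: exp_minus field_simps)
    also have "\<dots> \<le> exp (M * T) * H 0"
      using mult_left_mono[of s T M] s M Hpos[of 0] by (intro mult_right_mono) simp_all
    finally show ?thesis .
  qed
  show ?thesis
  proof (cases "t \<le> T")
    case True
    then show ?thesis using up_to_T t by (simp add: I_def)
  next
    case False
    have "H t + I t \<le> H T + I T"
    proof (rule DERIV_nonpos_imp_decreasing_open[of T t "\<lambda>t. H t + I t"])
      show "T \<le> t" using False by simp
      fix z assume z: "T < z" "z < t"
      then have "((\<lambda>t. H t + I t) has_real_derivative H' z + D z) (at z)"
        using T by (intro DERIV_add Hat Iat) auto
      then show "\<exists>y. ((\<lambda>t. H t + I t) has_real_derivative y) (at z) \<and> y \<le> 0"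
        using late[of z] z by force
    qed (intro continuous_intros contH contI T)
    then show ?thesis using up_to_T[OF T] by (simp add: I_def)
  qed
qed

section \<open>The energy of the viscous system\<close>

text \<open>Integrating the divergence form of the local energy balance; the flux \<open>\<Phi>\<close> below vanishes at
  both ends by the boundary conditions. Multiplying the equation for \<open>r\<close> by \<open>\<tau>(r) - \<tau>b\<close> instead of
  \<open>\<tau>(r)\<close> is what removes the uncontrolled traces of \<open>p\<close> and \<open>r\<^sub>x\<close> at the right end.\<close>

lemma flux_identity:
  assumes sol: "viscous_solution \<delta> \<tau> \<tau>b rin pin r p"
    and C: "Ck_on 3 UNIV \<tau>" and surj: "surj \<tau>" and t: "0 \<le> t"
  shows "((\<lambda>x. p t x * dt p t x + (\<tau> (r t x) - \<tau>b t) * dt r t x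
            + \<delta> * ((dx (p t) x)\<^sup>2 + deriv \<tau> (r t x) * (dx (r t) x)\<^sup>2)) has_integral 0) {0..1}"
proof -
  note rp = sol[unfolded viscous_solution_def]
  have C2: "C0_time_C2_space r" "C0_time_C2_space p" using rp by auto
  note d\<tau> = tension_derivatives(1)[OF C]
  define \<Phi> where "\<Phi> = (\<lambda>x. p t x * (\<tau> (r t x) - \<tau>b t) + \<delta> * (p t x * dx (p t) x)
      + \<delta> * ((\<tau> (r t x) - \<tau>b t) * dx (r t) x))"
  define \<phi> where "\<phi> = (\<lambda>x. p t x * dt p t x + (\<tau> (r t x) - \<tau>b t) * dt r t x
            + \<delta> * ((dx (p t) x)\<^sup>2 + deriv \<tau> (r t x) * (dx (r t) x)\<^sup>2))"
  have d: "(\<Phi> has_real_derivative \<phi> x) (at x within {0..1})" if x: "x \<in> {0..1}" for x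
  proof -
    note dr = slice_has_derivative[OF C2(1) t x] and dp = slice_has_derivative[OF C2(2) t x]
    have chain: "((\<lambda>y. \<tau> (r t y)) has_real_derivative deriv \<tau> (r t x) * dx (r t) x) (at x within {0..1})"
      using DERIV_chain2[OF d\<tau> dr(1)] .
    have eqs: "dt r t x = dx (p t) x + \<delta> * (dx ^^ 2) (r t) x"
      "dt p t x = deriv \<tau> (r t x) * dx (r t) x + \<delta> * (dx ^^ 2) (p t) x"
      using rp t x deriv_on_eqI[OF chain at_within_unit_interval[OF x]] by (auto simp: algebra_simps)
    show ?thesis
      unfolding \<Phi>_def \<phi>_def eqs
      by (auto intro!: derivative_eq_intros dr dp chain simp: algebra_simps power2_eq_square)
  qed
  have "(\<phi> has_integral \<Phi> 1 - \<Phi> 0) {0..1}"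
    by (rule fundamental_theorem_of_calculus)
      (use d in \<open>auto simp: has_real_derivative_iff_has_vector_derivative\<close>)
  moreover have "\<Phi> 1 = 0" "\<Phi> 0 = 0"
    using rp t by (auto simp: \<Phi>_def surj_f_inv_f[OF surj])
  ultimately show ?thesis by (simp add: \<phi>_def)
qed

lemma energy_identity:
  assumes sol: "viscous_solution \<delta> \<tau> \<tau>b rin pin r p"
    and C: "Ck_on 3 UNIV \<tau>" and surj: "surj \<tau>"
    and b: "Ck_on 1 {0..} \<tau>b"
    and F: "\<And>x. (F has_real_derivative \<tau> x) (at x)"
    and t: "0 \<le> t"
  shows "((\<lambda>t. integral {0..1} (\<lambda>x. (p t x)\<^sup>2 / 2 + F (r t x) - \<tau>b t * r t x + K))
    has_real_derivative
      - deriv_on {0..} \<tau>b t * integral {0..1} (r t)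
      - \<delta> * integral {0..1} (\<lambda>x. (dx (p t) x)\<^sup>2 + deriv \<tau> (r t x) * (dx (r t) x)\<^sup>2))
    (at t within {0..})"
proof -
  note rp = sol[unfolded viscous_solution_def]
  have C2: "C0_time_C2_space r" "C0_time_C2_space p"
    and C1: "C1_time_C0_space r" "C1_time_C0_space p" using rp by auto
  define \<tau>b' where "\<tau>b' = deriv_on {0..} \<tau>b"
  have db: "(\<tau>b has_real_derivative \<tau>b' t) (at t within {0..})" if "0 \<le> t" for t
    using Ck_on_has_derivative[OF b, of 0 t] at_within_half_line that by (simp add: \<tau>b'_def)
  have cb: "continuous_on {0..} \<tau>b" "continuous_on {0..} \<tau>b'"
    using Ck_on_continuous[OF b, of 0] Ck_on_continuous[OF b, of 1] by (simp_all add: \<tau>b'_def)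
  have c\<tau>: "continuous_on UNIV \<tau>" and c\<tau>': "continuous_on UNIV (deriv \<tau>)"
    and cF: "continuous_on UNIV F"
    using DERIV_continuous_on tension_derivatives[OF C] F by blast+
  define h where "h = (\<lambda>t x. (p t x)\<^sup>2 / 2 + F (r t x) - \<tau>b t * r t x + K)"
  define h' where "h' = (\<lambda>t x. p t x * dt p t x + (\<tau> (r t x) - \<tau>b t) * dt r t x - \<tau>b' t * r t x)"
  define G where "G = (\<lambda>x. (dx (p t) x)\<^sup>2 + deriv \<tau> (r t x) * (dx (r t) x)\<^sup>2)"
  note cont2 = continuous_on_sections[OF C2(1)] continuous_on_sections[OF C2(2)]
    C1_time_continuous_dt[OF C1(1), unfolded split_beta] C1_time_continuous_dt[OF C1(2), unfolded split_beta]
  have "((\<lambda>t. integral (cbox 0 1) (h t)) has_field_derivative integral (cbox 0 1) (h' t)) (at t within {0..})"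
  proof (rule leibniz_rule_field_derivative)
    fix s x :: real assume "s \<in> {0..}" "x \<in> cbox 0 1"
    then have s: "0 \<le> s" and x: "x \<in> {0..1}" by auto
    note dr = C1_time_has_derivative[OF C1(1) s x] and dp = C1_time_has_derivative[OF C1(2) s x]
    show "((\<lambda>s. h s x) has_field_derivative h' s x) (at s within {0..})"
      unfolding h_def h'_def
      by (auto intro!: derivative_eq_intros dr dp db s DERIV_chain2[OF F] simp: algebra_simps)
  next
    fix s :: real assume "s \<in> {0..}"
    then show "h s integrable_on cbox 0 1"
      unfolding h_def box_real
      by (intro integrable_continuous_interval continuous_intros cont2
          continuous_on_compose2[OF cF]) auto
  next
    have "continuous_on ({0..} \<times> {0..1::real}) (\<lambda>z. \<tau>b (fst z))" "continuous_on ({0..} \<times> {0..1::real}) (\<lambda>z. \<tau>b' (fst z))"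
      by (auto intro!: continuous_on_compose2[OF cb(1)] continuous_on_compose2[OF cb(2)] continuous_intros)
    then show "continuous_on ({0..} \<times> cbox 0 1) (\<lambda>(s, x). h' s x)"
      unfolding h'_def split_beta box_real
      by (intro continuous_intros cont2 continuous_on_compose2[OF c\<tau>]) auto
  qed (use t in auto)
  moreover have "integral {0..1} (h' t) = - \<tau>b' t * integral {0..1} (r t) - \<delta> * integral {0..1} G"
  proof -
    have "G integrable_on {0..1}"
      unfolding G_def using t
      by (intro integrable_continuous_interval continuous_intros cont2 continuous_on_compose2[OF c\<tau>']) auto
    then have 1: "((\<lambda>x. \<delta> * G x) has_integral \<delta> * integral {0..1} G) {0..1}"
      by (intro has_integral_mult_right integrable_integral)
    have 2: "((\<lambda>x. \<tau>b' t * r t x) has_integral \<tau>b' t * integral {0..1} (r t)) {0..1}"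
      using t by (intro has_integral_mult_right integrable_integral integrable_continuous_interval cont2)
    have "(h' t has_integral 0 - \<delta> * integral {0..1} G - \<tau>b' t * integral {0..1} (r t)) {0..1}"
      using has_integral_diff[OF has_integral_diff[OF flux_identity[OF sol C surj t] 1] 2]
      by (simp add: h'_def G_def)
    then show ?thesis by (simp add: integral_unique)
  qed
  ultimately show ?thesis by (simp add: h_def G_def \<tau>b'_def)
qed

text \<open>The constants are fixed before \<open>\<delta>\<close> and the solution: they depend on \<open>\<tau>\<close> and \<open>\<tau>b\<close> only.\<close>

lemma uniform_energy_bound:
  assumes "tension \<tau>" and "boundary_tension \<tau>b"
  obtains a L N where "0 < a" and "0 \<le> L"
    and "\<And>\<delta> rin pin r p t. 0 < \<delta> \<Longrightarrow> viscous_solution \<delta> \<tau> \<tau>b rin pin r p \<Longrightarrow> 0 \<le> t \<Longrightarrow>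
      a * (integral {0..1} (\<lambda>x. (r t x)\<^sup>2 + (p t x)\<^sup>2)
        + \<delta> * integral {0..t} (\<lambda>s. integral {0..1} (\<lambda>x. (dx (r s) x)\<^sup>2 + (dx (p s) x)\<^sup>2)))
      \<le> L * integral {0..1} (\<lambda>x. (r 0 x)\<^sup>2 + (p 0 x)\<^sup>2) + N"
proof -
  obtain c1 c2 where C: "Ck_on 3 UNIV \<tau>" and c1: "0 < c1"
    and c: "\<And>x. c1 \<le> deriv \<tau> x" "\<And>x. deriv \<tau> x \<le> c2"
    using assms(1) unfolding tension_def by blast
  have c12: "c1 \<le> c2" using c order_trans by blast
  have surj: "surj \<tau>" by (rule surj_of_deriv_bounded_below[OF tension_derivatives(1)[OF C] c1 c(1)])
  define \<tau>b' where "\<tau>b' = deriv_on {0..} \<tau>b"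
  obtain B where B: "\<And>t. 0 \<le> t \<Longrightarrow> \<bar>\<tau>b t\<bar> \<le> B"
    using assms(2) unfolding boundary_tension_def bounded_iff by auto
  obtain B' where B': "\<And>t. 0 \<le> t \<Longrightarrow> \<bar>\<tau>b' t\<bar> \<le> B'"
    using assms(2) unfolding boundary_tension_def bounded_iff \<tau>b'_def by auto
  obtain T where T: "0 \<le> T" "\<And>t. T \<le> t \<Longrightarrow> \<tau>b' t = 0"
    using assms(2) unfolding boundary_tension_def \<tau>b'_def by auto
  have b: "Ck_on 1 {0..} \<tau>b" using assms(2) unfolding boundary_tension_def smooth_fun_on_def by blast
  obtain F where F: "\<And>x. (F has_real_derivative \<tau> x) (at x)"
    and F_bounds: "\<And>x. \<tau> 0 * x + c1 / 2 * x\<^sup>2 \<le> F x" "\<And>x. F x \<le> \<tau> 0 * x + c2 / 2 * x\<^sup>2"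
    using potential_exists[OF C c] by blast
  have cF: "continuous_on UNIV F" using DERIV_continuous_on F by blast
  have c\<tau>': "continuous_on UNIV (deriv \<tau>)" by (rule tension_derivatives(2)[OF C])
  define A where "A = \<bar>\<tau> 0\<bar> + B"
  define a where "a = min (1/2) (c1/4)"
  define K where "K = A\<^sup>2 / c1 + a"
  define M where "M = B' / a"
  define L where "L = exp (M * T) * (1/2 + A + c2/2)"
  define N where "N = exp (M * T) * (A + K)"
  have a: "0 < a" "a \<le> 1" "a \<le> c1" using c1 by (auto simp: a_def)
  have B0: "0 \<le> B" "0 \<le> B'" using B[of 0] B'[of 0] by auto
  have A0: "0 \<le> A" and K0: "0 \<le> K" and M0: "0 \<le> M"
    using B0 a c1 by (auto simp: A_def K_def M_def)
  have bounds: "a * (r\<^sup>2 + p\<^sup>2 + 1) \<le> p\<^sup>2 / 2 + F r - \<tau>b t * r + K"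
    "p\<^sup>2 / 2 + F r - \<tau>b t * r + K \<le> (1/2 + A + c2/2) * (r\<^sup>2 + p\<^sup>2) + (A + K)"
    if "0 \<le> t" for r p t
    using energy_density_bounds[of c1 "\<tau> 0" "\<tau>b t" A r "F r" c2 p] c1 c12 F_bounds B[OF that]
    by (simp_all add: A_def a_def K_def)
  show ?thesis
  proof (rule that[of a L N])
    show "0 < a" by fact
    show "0 \<le> L" using A0 c1 c12 by (simp add: L_def)
    fix \<delta> t :: real and rin pin and r p :: "real \<Rightarrow> real \<Rightarrow> real"
    assume \<delta>: "0 < \<delta>" and sol: "viscous_solution \<delta> \<tau> \<tau>b rin pin r p" and t: "0 \<le> t"
    have C2: "C0_time_C2_space r" "C0_time_C2_space p"
      using sol unfolding viscous_solution_def by auto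
    note cont = continuous_on_sections[OF C2(1)] continuous_on_sections[OF C2(2)]
    define h where "h = (\<lambda>t x. (p t x)\<^sup>2 / 2 + F (r t x) - \<tau>b t * r t x + K)"
    define q where "q = (\<lambda>t x. (r t x)\<^sup>2 + (p t x)\<^sup>2)"
    define g where "g = (\<lambda>t x. (dx (r t) x)\<^sup>2 + (dx (p t) x)\<^sup>2)"
    define H where "H = (\<lambda>t. integral {0..1} (h t))"
    define D where "D = (\<lambda>t. a * \<delta> * integral {0..1} (g t))"
    define H' where "H' = (\<lambda>t. - \<tau>b' t * integral {0..1} (r t)
      - \<delta> * integral {0..1} (\<lambda>x. (dx (p t) x)\<^sup>2 + deriv \<tau> (r t x) * (dx (r t) x)\<^sup>2))"
    have int: "h t integrable_on {0..1}" "q t integrable_on {0..1}" "g t integrable_on {0..1}"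
      "r t integrable_on {0..1}"
      "(\<lambda>x. (dx (p t) x)\<^sup>2 + deriv \<tau> (r t x) * (dx (r t) x)\<^sup>2) integrable_on {0..1}" if "0 \<le> t" for t
      unfolding h_def q_def g_def using that
      by (intro integrable_continuous_interval continuous_intros cont
          continuous_on_compose2[OF cF] continuous_on_compose2[OF c\<tau>']; simp)+
    have q_plus: "integral {0..1} (\<lambda>x. k * q t x + m) = k * integral {0..1} (q t) + m"
      if "0 \<le> t" for t k m
      using integral_add[OF integrable_on_mult_right[OF int(2)[OF that]] integrable_const_ivl, of k m] by simp
    have H_lower: "a * (integral {0..1} (q t) + 1) \<le> H t" if "0 \<le> t" for t
    proof -
      have "integral {0..1} (\<lambda>x. a * (q t x + 1)) \<le> H t"
        unfolding H_def using bounds(1)[OF that] int[OF that]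
        by (intro integral_le) (auto simp: h_def q_def intro!: integrable_on_mult_right integrable_add)
      then show ?thesis using q_plus[OF that, of 1 1] by simp
    qed
    have q_nonneg: "0 \<le> integral {0..1} (q t)" if "0 \<le> t" for t
      using int(2)[OF that] by (intro integral_nonneg) (auto simp: q_def)
    have mean: "\<bar>integral {0..1} (r t)\<bar> \<le> H t / a" if "0 \<le> t" for t
    proof -
      have "norm (integral {0..1} (r t)) \<le> integral {0..1} (\<lambda>x. q t x + 1)"
      proof (rule integral_norm_bound_integral)
        fix x
        have "0 \<le> (\<bar>r t x\<bar> - 1)\<^sup>2 + (r t x)\<^sup>2 + 2 * (p t x)\<^sup>2 + 1" by simp
        then show "norm (r t x) \<le> q t x + 1" by (simp add: q_def power2_diff)
      qed (use int[OF that] in \<open>auto intro: integrable_add\<close>)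
      also have "\<dots> \<le> H t / a"
        using H_lower[OF that] a q_plus[OF that, of 1 1] by (simp add: field_simps)
      finally show ?thesis by simp
    qed
    \<comment> \<open>This is where \<open>\<tau>'\<close> being bounded away from zero makes the strain gradient dissipative.\<close>
    have dissipation: "D t \<le> \<delta> * integral {0..1} (\<lambda>x. (dx (p t) x)\<^sup>2 + deriv \<tau> (r t x) * (dx (r t) x)\<^sup>2)"
      if "0 \<le> t" for t
    proof -
      have "integral {0..1} (\<lambda>x. a * g t x)
        \<le> integral {0..1} (\<lambda>x. (dx (p t) x)\<^sup>2 + deriv \<tau> (r t x) * (dx (r t) x)\<^sup>2)"
      proof (rule integral_le)
        fix x
        have "a * (dx (p t) x)\<^sup>2 \<le> 1 * (dx (p t) x)\<^sup>2"
          "a * (dx (r t) x)\<^sup>2 \<le> deriv \<tau> (r t x) * (dx (r t) x)\<^sup>2"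
          using a c(1)[of "r t x"] by (intro mult_right_mono; simp)+
        then show "a * g t x \<le> (dx (p t) x)\<^sup>2 + deriv \<tau> (r t x) * (dx (r t) x)\<^sup>2"
          by (simp add: g_def algebra_simps)
      qed (use int[OF that] in \<open>auto intro: integrable_on_mult_right\<close>)
      then have "\<delta> * integral {0..1} (\<lambda>x. a * g t x)
        \<le> \<delta> * integral {0..1} (\<lambda>x. (dx (p t) x)\<^sup>2 + deriv \<tau> (r t x) * (dx (r t) x)\<^sup>2)"
        using \<delta> by (intro mult_left_mono) auto
      then show ?thesis by (simp add: D_def mult_ac)
    qed
    have "H t + integral {0..t} D \<le> exp (M * T) * H 0"
    proof (rule dissipative_gronwall[of H H' D T M])
      show "(H has_real_derivative H' t) (at t within {0..})" if "0 \<le> t" for t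
        using energy_identity[OF sol C surj b F that, of K]
        by (simp add: H_def H'_def h_def \<tau>b'_def)
      have "continuous_on {0..} (\<lambda>t. integral (cbox 0 1) (g t))"
        by (rule integral_continuous_on_param)
          (auto simp: g_def split_beta intro!: continuous_intros cont)
      then show "continuous_on {0..} D" unfolding D_def by (auto intro!: continuous_intros)
      show "0 \<le> D t" if "0 \<le> t" for t
        unfolding D_def using a \<delta> int(3)[OF that]
        by (intro mult_nonneg_nonneg integral_nonneg) (auto simp: g_def)
      show "0 \<le> H t" if "0 \<le> t" for t
      proof -
        have "0 \<le> a * (integral {0..1} (q t) + 1)" using a q_nonneg[OF that] by simp
        with H_lower[OF that] show ?thesis by linarith
      qed
      show "H' t \<le> M * H t - D t" if "0 \<le> t" for t
      proof -
        have "\<bar>\<tau>b' t * integral {0..1} (r t)\<bar> \<le> B' * (H t / a)"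
          unfolding abs_mult using B'[OF that] mean[OF that] B0 by (intro mult_mono) auto
        then show ?thesis using dissipation[OF that] by (simp add: H'_def M_def)
      qed
      show "H' t \<le> - D t" if "T \<le> t" for t
        using dissipation[of t] T that by (simp add: H'_def)
    qed (use T M0 t in auto)
    moreover have "integral {0..t} D = a * (\<delta> * integral {0..t} (\<lambda>s. integral {0..1} (g s)))"
      by (simp add: D_def mult.assoc)
    moreover have "a * integral {0..1} (q t) \<le> H t"
      using H_lower[OF t] a by (simp add: algebra_simps)
    moreover have "exp (M * T) * H 0 \<le> L * integral {0..1} (q 0) + N"
    proof -
      have "H 0 \<le> integral {0..1} (\<lambda>x. (1/2 + A + c2/2) * q 0 x + (A + K))"
        unfolding H_def using bounds(2)[of 0] int[of 0]
        by (intro integral_le) (auto simp: h_def q_def intro!: integrable_on_mult_right integrable_add)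
      also have "\<dots> = (1/2 + A + c2/2) * integral {0..1} (q 0) + (A + K)"
        by (rule q_plus) simp
      finally have "exp (M * T) * H 0 \<le> exp (M * T) * \<dots>" by (intro mult_left_mono) auto
      then show ?thesis by (simp add: L_def N_def algebra_simps)
    qed
    ultimately show "a * (integral {0..1} (\<lambda>x. (r t x)\<^sup>2 + (p t x)\<^sup>2)
        + \<delta> * integral {0..t} (\<lambda>s. integral {0..1} (\<lambda>x. (dx (r s) x)\<^sup>2 + (dx (p s) x)\<^sup>2)))
      \<le> L * integral {0..1} (\<lambda>x. (r 0 x)\<^sup>2 + (p 0 x)\<^sup>2) + N"
      by (simp add: q_def g_def algebra_simps)
  qed
qed

section \<open>Uniformly bounded initial data and the resulting estimate\<close>

text \<open>Passes from the Lebesgue integral over the open interval, in which the data are measured, to the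
  gauge integral over the closed one, in which the energy is written.\<close>

lemma L2norm_on_open_unit_interval:
  assumes "continuous_on {0..1} f"
  shows "(L2norm_on {0<..<1} f)\<^sup>2 = integral {0..1} (\<lambda>x. (f x)\<^sup>2)"
proof -
  have "(\<lambda>x. (f x)\<^sup>2) absolutely_integrable_on cbox 0 1"
    using assms by (intro absolutely_integrable_continuous) (auto intro!: continuous_intros)
  then have "integrable (lebesgue_on (box 0 1)) (\<lambda>x. (f x)\<^sup>2)"
    by (intro absolutely_integrable_imp_integrable) (simp_all only: absolutely_integrable_on_open_interval lmeasurable_box fmeasurableD)
  then have "(LINT x|lebesgue_on (box 0 1). (f x)\<^sup>2) = integral (box 0 1) (\<lambda>x. (f x)\<^sup>2)"
    by (intro lebesgue_integral_eq_integral) auto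
  moreover have "(L2norm_on {0<..<1} f)\<^sup>2 = (LINT x|lebesgue_on (box 0 1). (f x)\<^sup>2)"
    by (simp add: L2norm_on_def)
  ultimately show ?thesis
    by (simp add: integral_open_interval_real)
qed

lemma L2norm_on_nonneg: "0 \<le> L2norm_on S f"
  by (simp add: L2norm_on_def)

lemma mollified_initial_data_bound:
  assumes "mollified_initial_data \<tau> \<tau>b r0 p0 r0\<delta> p0\<delta>"
  obtains E where "\<And>\<delta>. 0 < \<delta> \<Longrightarrow> integral {0..1} (\<lambda>x. (r0\<delta> \<delta> x)\<^sup>2 + (p0\<delta> \<delta> x)\<^sup>2) \<le> E"
proof -
  from assms obtain C' where C': "\<And>\<delta>. 0 < \<delta> \<Longrightarrow>
    L2norm_on {0<..<1} (r0\<delta> \<delta>) + L2norm_on {0<..<1} (p0\<delta> \<delta>)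
        + L2norm_on {0<..<1} (\<lambda>x. sqrt \<delta> * dx (r0\<delta> \<delta>) x)
        + L2norm_on {0<..<1} (\<lambda>x. sqrt \<delta> * dx (p0\<delta> \<delta>) x) \<le> C'"
    unfolding mollified_initial_data_def by blast
  show ?thesis
  proof (rule that[of "C'\<^sup>2 + C'\<^sup>2"])
    fix \<delta> :: real assume \<delta>: "0 < \<delta>"
    have "Ck_on 0 {0..1} (r0\<delta> \<delta>)" "Ck_on 0 {0..1} (p0\<delta> \<delta>)"
      using assms \<delta> unfolding mollified_initial_data_def smooth_fun_on_def by blast+
    then have cont: "continuous_on {0..1} (r0\<delta> \<delta>)" "continuous_on {0..1} (p0\<delta> \<delta>)"
      by (simp_all add: Ck_on_def)
    have "L2norm_on {0<..<1} (r0\<delta> \<delta>) \<le> C'" "L2norm_on {0<..<1} (p0\<delta> \<delta>) \<le> C'"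
      using C'[OF \<delta>] L2norm_on_nonneg[of "{0<..<1}" "r0\<delta> \<delta>"] L2norm_on_nonneg[of "{0<..<1}" "p0\<delta> \<delta>"]
        L2norm_on_nonneg[of "{0<..<1}" "\<lambda>x. sqrt \<delta> * dx (r0\<delta> \<delta>) x"]
        L2norm_on_nonneg[of "{0<..<1}" "\<lambda>x. sqrt \<delta> * dx (p0\<delta> \<delta>) x"]
      by linarith+
    then have "integral {0..1} (\<lambda>x. (r0\<delta> \<delta> x)\<^sup>2) \<le> C'\<^sup>2" "integral {0..1} (\<lambda>x. (p0\<delta> \<delta> x)\<^sup>2) \<le> C'\<^sup>2"
      unfolding L2norm_on_open_unit_interval[OF cont(1), symmetric]
        L2norm_on_open_unit_interval[OF cont(2), symmetric]
      by (intro power_mono L2norm_on_nonneg; simp)+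
    moreover have "(\<lambda>x. (r0\<delta> \<delta> x)\<^sup>2) integrable_on {0..1}" "(\<lambda>x. (p0\<delta> \<delta> x)\<^sup>2) integrable_on {0..1}"
      by (intro integrable_continuous_interval continuous_intros cont)+
    ultimately show "integral {0..1} (\<lambda>x. (r0\<delta> \<delta> x)\<^sup>2 + (p0\<delta> \<delta> x)\<^sup>2) \<le> C'\<^sup>2 + C'\<^sup>2"
      by (simp add: integral_add)
  qed
qed

theorem theorem3p1:
  fixes \<tau> \<tau>b r0 p0 :: "real \<Rightarrow> real"
    and r0\<delta> p0\<delta> :: "real \<Rightarrow> real \<Rightarrow> real"
    and r p :: "real \<Rightarrow> real \<Rightarrow> real \<Rightarrow> real"
  assumes "tension \<tau>"
    and "boundary_tension \<tau>b"
    and "limit_initial_data \<tau> \<tau>b r0 p0"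
    and "mollified_initial_data \<tau> \<tau>b r0 p0 r0\<delta> p0\<delta>"
    and "\<And>\<delta>. \<delta> > 0 \<Longrightarrow> viscous_solution \<delta> \<tau> \<tau>b (r0\<delta> \<delta>) (p0\<delta> \<delta>) (r \<delta>) (p \<delta>)"
  shows "\<exists>C>0. \<forall>t\<ge>0. \<forall>\<delta>>0.
    integral {0..1} (\<lambda>x. (r \<delta> t x)\<^sup>2 + (p \<delta> t x)\<^sup>2)
    + \<delta> * integral {0..t} (\<lambda>s. integral {0..1} (\<lambda>x. (dx (r \<delta> s) x)\<^sup>2 + (dx (p \<delta> s) x)\<^sup>2)) \<le> C"
proof -
  obtain a L N where a: "0 < a" and L: "0 \<le> L" and bound:
    "\<And>\<delta> rin pin r p t. 0 < \<delta> \<Longrightarrow> viscous_solution \<delta> \<tau> \<tau>b rin pin r p \<Longrightarrow> 0 \<le> t \<Longrightarrow>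
      a * (integral {0..1} (\<lambda>x. (r t x)\<^sup>2 + (p t x)\<^sup>2)
        + \<delta> * integral {0..t} (\<lambda>s. integral {0..1} (\<lambda>x. (dx (r s) x)\<^sup>2 + (dx (p s) x)\<^sup>2)))
      \<le> L * integral {0..1} (\<lambda>x. (r 0 x)\<^sup>2 + (p 0 x)\<^sup>2) + N"
    by (rule uniform_energy_bound[OF assms(1,2)]) blast
  obtain E where E: "\<And>\<delta>. 0 < \<delta> \<Longrightarrow> integral {0..1} (\<lambda>x. (r0\<delta> \<delta> x)\<^sup>2 + (p0\<delta> \<delta> x)\<^sup>2) \<le> E"
    using mollified_initial_data_bound[OF assms(4)] by blast
  show ?thesis
  proof (intro exI[of _ "max 1 ((L * E + N) / a)"] conjI allI impI)
    fix t \<delta> :: real assume t: "0 \<le> t" and \<delta>: "0 < \<delta>"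
    let ?Q = "integral {0..1} (\<lambda>x. (r \<delta> t x)\<^sup>2 + (p \<delta> t x)\<^sup>2)
      + \<delta> * integral {0..t} (\<lambda>s. integral {0..1} (\<lambda>x. (dx (r \<delta> s) x)\<^sup>2 + (dx (p \<delta> s) x)\<^sup>2))"
    have "integral {0..1} (\<lambda>x. (r \<delta> 0 x)\<^sup>2 + (p \<delta> 0 x)\<^sup>2)
        = integral {0..1} (\<lambda>x. (r0\<delta> \<delta> x)\<^sup>2 + (p0\<delta> \<delta> x)\<^sup>2)"
      using assms(5)[OF \<delta>] unfolding viscous_solution_def by (intro integral_cong) auto
    then have "integral {0..1} (\<lambda>x. (r \<delta> 0 x)\<^sup>2 + (p \<delta> 0 x)\<^sup>2) \<le> E" using E[OF \<delta>] by simp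
    from bound[OF \<delta> assms(5)[OF \<delta>] t] mult_left_mono[OF this L] have "a * ?Q \<le> L * E + N" by linarith
    then have "?Q \<le> (L * E + N) / a" using a by (simp add: pos_le_divide_eq mult.commute)
    then show "?Q \<le> max 1 ((L * E + N) / a)" by linarith
  qed simp
qed

end
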